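(* Consider the MAX cost. Let $G$ be an $s$–$t$ graph whose $s$–$t$ paths $p_1,\dots,p_m$ ($m>1$) are pairwise disjoint, with $|p_1|\le\dots\le|p_m|$ and $|p_1|<|p_m|$. Let $m_1$ be the largest integer such that $|p_1|=\dots=|p_{m_1}|$. For every $n,k>1$ and every $\alpha>\frac{|p_m|-|p_1|}{k}$, if $$\min_{\sigma\in(\Delta(P_{st}))^n}F_n(\sigma,\alpha)<|p_1|+\frac{\mathcal{E}_{m_1,n}}{m_1}k\alpha,$$ then $$\min_{\sigma\in(\Delta(P_{st}))^n}F_n(\sigma,\alpha)<\min_{\sigma\in\mathcal{U}_n}F_n(\sigma,\alpha).$$
   Context: Graph: $G=(V,E,s,t)$ is a finite directed acyclic multigraph ($E$ is a multiset) with source $s$ and sink $t\neq s$, such that every edge lies on some directed $s$–$t$ path. $P_{st}=\{p_1,\dots,p_m\}$ is the set of directed $s$–$t$ paths; a path is treated as a set of edges, $|p|$ is its number of edges, and "disjoint" means disjoint as edge sets. $P_i=\{p_1,\dots,p_i\}$. Strategies: each of the $n$ agents picks a path, giving $a=(a_1,\dots,a_n)\in(P_{st})^n$; the $k$ interceptors pick $d=(d_1,\dots,d_k)\in E^k$. $\Delta X$ is the set of probability distributions on $X$. An element $\sigma=(\sigma_1,\dots,\sigma_n)\in(\Delta(P_{st}))^n$ is identified with the product distribution on $(P_{st})^n$. MAX cost: $C(a,d,\alpha)=\max_{i\in[n]}\left(|a_i|+\alpha\sum_{j\in[k]}\mathbf 1\{d_j\in a_i\}\right)$, and $F_n(\sigma,\alpha)=\max_{d\in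 E^k}\mathbb{E}_{a\sim\sigma}[C(a,d,\alpha)]$. Uniform strategies (for disjoint paths): $\mathcal{U}_n=\{U_{P_i}^n:1\le i\le m\}$, where $U_P$ is the uniform distribution on $P$ and $U_P^n$ is the product of $n$ copies of it. Notation: $\mathcal{E}_{\ell,n}=\ell\left(1-\left(1-\frac1\ell\right)^n\right)$. *)

theory Defs
  imports "HOL-Probability.Probability" "HOL-Probability.Product_PMF" "Graph_Theory.Arc_Walk"
begin

text \<open>
  The arcs of a \<^typ>\<open>('v, 'e) pre_digraph\<close> carry their own identity, so parallel edges are
  distinct arcs with the same ends.
\<close>

definition st_paths :: "('v, 'e) pre_digraph \<Rightarrow> 'v \<Rightarrow> 'v \<Rightarrow> 'e set set" where
  "st_paths G s t = {set w | w. pre_digraph.apath G s w t}"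

locale st_graph = fin_digraph G for G :: "('v, 'e) pre_digraph" (structure) +
  fixes s t :: 'v
  assumes source_in_verts: "s \<in> verts G"
    and sink_in_verts: "t \<in> verts G"
    and source_neq_sink: "s \<noteq> t"
    and acyclic: "\<nexists>c. cycle c"
    and arc_on_st_path: "e \<in> arcs G \<Longrightarrow> \<exists>P \<in> st_paths G s t. e \<in> P"

definition path_profiles :: "('v, 'e) pre_digraph \<Rightarrow> 'v \<Rightarrow> 'v \<Rightarrow> nat \<Rightarrow> (nat \<Rightarrow> 'e set pmf) set" where
  "path_profiles G s t n = {1..n} \<rightarrow>\<^sub>E {\<mu>. set_pmf \<mu> \<subseteq> st_paths G s t}"

definition max_cost :: "nat \<Rightarrow> nat \<Rightarrow> (nat \<Rightarrow> 'e set) \<Rightarrow> (nat \<Rightarrow> 'e) \<Rightarrow> real \<Rightarrow> real" where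
  "max_cost n k a d \<alpha> =
     Max ((\<lambda>i. real (card (a i)) + \<alpha> * (\<Sum>j\<in>{1..k}. of_bool (d j \<in> a i))) ` {1..n})"

text \<open>
  The second argument of \<^const>\<open>Pi_pmf\<close> is only the value given to indices outside \<open>{1..n}\<close>,
  which \<^const>\<open>max_cost\<close> never inspects.
\<close>

definition F_max ::
  "('v, 'e) pre_digraph \<Rightarrow> nat \<Rightarrow> nat \<Rightarrow> (nat \<Rightarrow> 'e set pmf) \<Rightarrow> real \<Rightarrow> real" where
  "F_max G n k \<sigma> \<alpha> =
     Max ((\<lambda>d. measure_pmf.expectation (Pi_pmf {1..n} {} \<sigma>) (\<lambda>a. max_cost n k a d \<alpha>))
            ` ({1..k} \<rightarrow>\<^sub>E arcs G))"

definition uniform_profiles :: "(nat \<Rightarrow> 'e set) \<Rightarrow> nat \<Rightarrow> nat \<Rightarrow> (nat \<Rightarrow> 'e set pmf) set" where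
  "uniform_profiles p m n = {(\<lambda>_\<in>{1..n}. pmf_of_set (p ` {1..i})) | i. i \<in> {1..m}}"

text \<open>
  An attained minimum over a possibly infinite set. It is \<^const>\<open>Least\<close> rather than
  \<^const>\<open>Inf\<close>, so nothing can be derived about it before attainment has been shown.
\<close>

definition minimum :: "('x \<Rightarrow> real) \<Rightarrow> 'x set \<Rightarrow> real" where
  "minimum f S = (LEAST v. v \<in> f ` S)"

lemma minimum_eqI:
  assumes "x \<in> S" "\<And>y. y \<in> S \<Longrightarrow> f x \<le> f y"
  shows "minimum f S = f x"
  unfolding minimum_def using assms by (intro Least_equality) auto

definition \<E> :: "nat \<Rightarrow> nat \<Rightarrow> real" where
  "\<E> l n = real l * (1 - (1 - 1 / real l) ^ n)"

end

theory Submission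
  imports Defs
begin

text \<open>
  Let \<open>V\<close> be the optimum, which is attained by compactness. The uniform profile on the first
  \<open>i \<le> m\<^sub>1\<close> paths already costs at least the assumed strict upper bound for \<open>V\<close> when all
  interceptors sit on \<open>p\<^sub>1\<close>. For \<open>i > m\<^sub>1\<close> the uniform profile is not optimal: let agent 1
  move a small amount of probability to \<open>p\<^sub>1\<close>. Interceptions avoiding \<open>p\<^sub>1\<close> become strictly
  cheaper. Interceptions hitting \<open>p\<^sub>1\<close> were strictly below the worst cost before the move, hence
  remain so: by convexity it suffices to see that concentrating on \<open>p\<^sub>1\<close> is strictly worse for
  the interceptors than concentrating on the longer path \<open>p\<^sub>i\<close>.
\<close>

section \<open>Expectations under product distributions of finite support\<close>

lemma continuous_on_Max_image:
  fixes f :: "'i \<Rightarrow> 'a::topological_space \<Rightarrow> real"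
  assumes "finite A" "A \<noteq> {}" "\<And>i. i \<in> A \<Longrightarrow> continuous_on S (f i)"
  shows "continuous_on S (\<lambda>x. Max ((\<lambda>i. f i x) ` A))"
  using assms
proof (induction A rule: finite_ne_induct)
  case (insert i A)
  then show ?case by (simp add: continuous_on_max)
qed simp

lemma expectation_mono_on_support:
  fixes f g :: "'a \<Rightarrow> real"
  assumes fin: "finite (set_pmf M)" and le: "\<And>a. a \<in> set_pmf M \<Longrightarrow> f a \<le> g a"
  shows "measure_pmf.expectation M f \<le> measure_pmf.expectation M g"
  using fin le by (intro integral_mono_AE) (auto simp: AE_measure_pmf_iff integrable_measure_pmf_finite)

lemma expectation_strict_mono_on_support:
  fixes f g :: "'a \<Rightarrow> real"
  assumes fin: "finite (set_pmf M)" and le: "\<And>a. a \<in> set_pmf M \<Longrightarrow> f a \<le> g a"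
    and less: "b \<in> set_pmf M" "f b < g b"
  shows "measure_pmf.expectation M f < measure_pmf.expectation M g"
proof -
  have E: "measure_pmf.expectation M h = (\<Sum>a\<in>set_pmf M. h a * pmf M a)" for h :: "'a \<Rightarrow> real"
    using fin by (intro integral_measure_pmf_real) auto
  show ?thesis
    unfolding E using fin le less
    by (intro sum_strict_mono_ex1) (auto intro!: mult_right_mono mult_strict_right_mono bexI[of _ b] simp: pmf_positive)
qed

text \<open>Exhibits the expectation as a polynomial in the numbers
  \<open>pmf (\<sigma> i) x\<close>; continuity in the profile and linearity in each single marginal
  are read off from it. The common bound \<open>S\<close> makes the index set independent of
  \<open>\<sigma>\<close>.\<close>

lemma expectation_Pi_pmf_eq_sum:
  fixes f :: "('i \<Rightarrow> 'b) \<Rightarrow> real"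
  assumes "finite A" "finite S" "\<And>i. i \<in> A \<Longrightarrow> set_pmf (\<sigma> i) \<subseteq> S"
  shows "measure_pmf.expectation (Pi_pmf A dflt \<sigma>) f
           = (\<Sum>a\<in>PiE_dflt A dflt (\<lambda>_. S). (\<Prod>i\<in>A. pmf (\<sigma> i) (a i)) * f a)"
proof -
  have "measure_pmf.expectation (Pi_pmf A dflt \<sigma>) f
          = (\<Sum>a\<in>PiE_dflt A dflt (\<lambda>_. S). f a * pmf (Pi_pmf A dflt \<sigma>) a)"
  proof (rule integral_measure_pmf_real)
    show "finite (PiE_dflt A dflt (\<lambda>_. S))" using assms by auto
    show "a \<in> PiE_dflt A dflt (\<lambda>_. S)" if "a \<in> set_pmf (Pi_pmf A dflt \<sigma>)" for a
      using that assms by (fastforce simp: set_Pi_pmf PiE_dflt_def)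
  qed
  also have "\<dots> = (\<Sum>a\<in>PiE_dflt A dflt (\<lambda>_. S). (\<Prod>i\<in>A. pmf (\<sigma> i) (a i)) * f a)"
    using assms by (intro sum.cong refl) (simp add: pmf_Pi' PiE_dflt_def)
  finally show ?thesis .
qed

lemma finite_set_Pi_pmf:
  assumes "finite A" "\<And>i. i \<in> A \<Longrightarrow> finite (set_pmf (\<sigma> i))"
  shows "finite (set_pmf (Pi_pmf A dflt \<sigma>))"
  using assms by (auto simp: set_Pi_pmf)

text \<open>A coupling: both profiles are evaluated on the same random outcome, so their costs can
  be compared outcome by outcome.\<close>

lemma expectation_Pi_pmf_return_upd:
  fixes f :: "('i \<Rightarrow> 'b) \<Rightarrow> real"
  assumes "finite A" "j \<in> A"
  shows "measure_pmf.expectation (Pi_pmf A dflt (\<sigma>(j := return_pmf y))) f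
           = measure_pmf.expectation (Pi_pmf A dflt \<sigma>) (\<lambda>a. f (a(j := y)))"
proof -
  define B where "B = A - {j}"
  have A: "A = insert j B" "finite B" "j \<notin> B" using assms by (auto simp: B_def)
  have "Pi_pmf A dflt (\<sigma>(j := return_pmf y)) = map_pmf (\<lambda>a. a(j := y)) (Pi_pmf B dflt (\<sigma>(j := return_pmf y)))"
    using A by (simp add: Pi_pmf_insert' bind_return_pmf map_pmf_def)
  also have "Pi_pmf B dflt (\<sigma>(j := return_pmf y)) = Pi_pmf B dflt \<sigma>"
    using A by (intro Pi_pmf_cong) auto
  also have "map_pmf (\<lambda>a. a(j := y)) (Pi_pmf B dflt \<sigma>) = map_pmf (\<lambda>a. a(j := y)) (Pi_pmf A dflt \<sigma>)"
    using A by (simp add: Pi_pmf_insert' map_bind_pmf map_pmf_def bind_assoc_pmf bind_return_pmf)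
  finally show ?thesis by (simp del: fun_upd_apply)
qed

text \<open>Each term of the polynomial contains exactly one factor of agent \<open>j\<close>, so
  the expectation is linear in that agent's distribution.\<close>

lemma expectation_Pi_pmf_mixture:
  fixes f :: "('i \<Rightarrow> 'b) \<Rightarrow> real"
  assumes A: "finite A" "j \<in> A" and S: "finite S" "\<And>i. i \<in> A \<Longrightarrow> set_pmf (\<sigma> i) \<subseteq> S" "set_pmf \<nu> \<subseteq> S"
    and \<epsilon>: "0 < \<epsilon>" "\<epsilon> < 1"
  shows "measure_pmf.expectation
           (Pi_pmf A dflt (\<sigma>(j := bind_pmf (bernoulli_pmf \<epsilon>) (\<lambda>b. if b then \<nu> else \<sigma> j)))) f
         = (1 - \<epsilon>) * measure_pmf.expectation (Pi_pmf A dflt \<sigma>) f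
           + \<epsilon> * measure_pmf.expectation (Pi_pmf A dflt (\<sigma>(j := \<nu>))) f"
proof -
  let ?mix = "bind_pmf (bernoulli_pmf \<epsilon>) (\<lambda>b. if b then \<nu> else \<sigma> j)"
  have E: "measure_pmf.expectation (Pi_pmf A dflt (\<sigma>(j := \<mu>))) f
      = (\<Sum>a\<in>PiE_dflt A dflt (\<lambda>_. S). pmf \<mu> (a j) * ((\<Prod>i\<in>A - {j}. pmf (\<sigma> i) (a i)) * f a))"
    if "set_pmf \<mu> \<subseteq> S" for \<mu>
  proof -
    have "(\<Prod>i\<in>A. pmf ((\<sigma>(j := \<mu>)) i) (a i)) = pmf \<mu> (a j) * (\<Prod>i\<in>A - {j}. pmf (\<sigma> i) (a i))" for a
      using A by (subst prod.remove[of _ j]) (auto intro!: prod.cong)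
    then show ?thesis
      using that S A by (subst expectation_Pi_pmf_eq_sum[where S = S]) (auto simp: mult.assoc)
  qed
  have "set_pmf ?mix \<subseteq> S" using S(2)[OF A(2)] S(3) by (auto simp: subset_iff split: if_splits)
  note E_mix = E[OF this]
  have pmf_mix: "pmf ?mix x = (1 - \<epsilon>) * pmf (\<sigma> j) x + \<epsilon> * pmf \<nu> x" for x
    using \<epsilon> by (simp add: pmf_bind mult.commute)
  show ?thesis
    using E[OF S(3)] E[OF S(2)[OF A(2)]]
    unfolding E_mix pmf_mix
    by (simp add: distrib_right sum.distrib mult.assoc sum_distrib_left)
qed

section \<open>Compactness of the space of profiles\<close>

text \<open>Identifying a profile with its table of probabilities turns the profiles into a closed
  subset of a product of compact sets, which is compact by Tychonoff even for infinite index
  types.\<close>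

lemma pmf_profiles_attain_min:
  fixes \<Phi> :: "('i \<times> 'b \<Rightarrow> real) \<Rightarrow> real"
  assumes S: "finite S" "S \<noteq> {}" and cont: "continuous_on UNIV \<Phi>"
  obtains \<sigma> where "\<And>i. set_pmf (\<sigma> i) \<subseteq> S"
    and "\<And>\<tau>. (\<And>i. set_pmf (\<tau> i) \<subseteq> S) \<Longrightarrow> \<Phi> (\<lambda>(i, x). pmf (\<sigma> i) x) \<le> \<Phi> (\<lambda>(i, x). pmf (\<tau> i) x)"
proof -
  \<comment> \<open>Coordinates outside \<open>S\<close> are pinned to 0, so every factor is compact
    and the sum over \<open>S\<close> is the total mass.\<close>
  define K where "K = {q. \<forall>i. (\<Sum>x\<in>S. q (i, x)) = 1}
      \<inter> PiE UNIV (\<lambda>(i::'i, x). if x \<in> S then {0..1::real} else {0})"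
  have "compactin (product_topology (\<lambda>_. euclidean) UNIV)
      (PiE UNIV (\<lambda>(i::'i, x). if x \<in> S then {0..1::real} else {0}))"
    by (auto simp: compactin_PiE split: prod.splits)
  moreover have "closed {q :: 'i \<times> 'b \<Rightarrow> real. \<forall>i. (\<Sum>x\<in>S. q (i, x)) = 1}"
    by (intro closed_Collect_all closed_Collect_eq continuous_on_sum continuous_on_product_coordinates continuous_on_const)
  ultimately have K: "compact K"
    unfolding K_def by (intro closed_Int_compact) (auto simp: euclidean_product_topology)
  have profile_in: "(\<lambda>(i, x). pmf (\<tau> i) x) \<in> K" if "\<And>i. set_pmf (\<tau> i) \<subseteq> S" for \<tau> :: "'i \<Rightarrow> 'b pmf"
  proof -
    have "pmf (\<tau> i) x = 0" if "x \<notin> S" for i x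
      using \<open>set_pmf (\<tau> i) \<subseteq> S\<close> that by (auto simp: set_pmf_iff)
    then show ?thesis
      using that S by (auto simp: K_def PiE_def Pi_def pmf_le_1 sum_pmf_eq_1)
  qed
  obtain x0 where "x0 \<in> S" using S by auto
  then have "K \<noteq> {}" using profile_in[of "\<lambda>_. return_pmf x0"] by auto
  then obtain q where q: "q \<in> K" "\<And>r. r \<in> K \<Longrightarrow> \<Phi> q \<le> \<Phi> r"
    using continuous_attains_inf[OF K _ continuous_on_subset[OF cont]] by blast
  \<comment> \<open>The minimising point is a family of mass functions, hence the table of a genuine
    profile.\<close>
  define \<sigma> where "\<sigma> i = embed_pmf (\<lambda>x. q (i, x))" for i
  have nonneg: "q (i, x) \<ge> 0" and outside: "x \<notin> S \<Longrightarrow> q (i, x) = 0" for i x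
    using q(1) by (auto simp: K_def PiE_def Pi_def split: if_splits)
      (metis (no_types) atLeastAtMost_iff order_refl singletonD)+
  have pmf_\<sigma>: "pmf (\<sigma> i) x = q (i, x)" for i x
    unfolding \<sigma>_def
  proof (rule pmf_embed_pmf)
    have "(\<integral>\<^sup>+x. ennreal (q (i, x)) \<partial>count_space UNIV) = (\<Sum>x\<in>S. ennreal (q (i, x)))"
      using S outside nonneg
      by (intro nn_integral_count_space'[of S]) (auto simp: less_le)
    also have "\<dots> = ennreal (\<Sum>x\<in>S. q (i, x))" using nonneg by (intro sum_ennreal) auto
    also have "\<dots> = 1" using q(1) by (simp add: K_def)
    finally show "(\<integral>\<^sup>+x. ennreal (q (i, x)) \<partial>count_space UNIV) = 1" .
  qed (rule nonneg)
  show thesis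
  proof (rule that)
    show "set_pmf (\<sigma> i) \<subseteq> S" for i
      by (rule subsetI, rule ccontr) (simp add: set_pmf_iff pmf_\<sigma> outside)
    show "\<Phi> (\<lambda>(i, x). pmf (\<sigma> i) x) \<le> \<Phi> (\<lambda>(i, x). pmf (\<tau> i) x)"
      if "\<And>i. set_pmf (\<tau> i) \<subseteq> S" for \<tau>
      using q(2)[OF profile_in[OF that]] by (simp add: pmf_\<sigma>)
  qed
qed

section \<open>The interception game on pairwise disjoint arc sets\<close>

text \<open>Only the arc sets of the paths matter here. \<open>spread\<close> encodes the bound on
  \<alpha>: a route hit by all interceptors costs at least as much as any route left free.\<close>

locale disjoint_routes =
  fixes E :: "'e set" and P :: "'e set set" and n k :: nat and \<alpha> :: real
  assumes finite_arcs: "finite E" and finite_routes: "finite P"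
    and route_arcs: "x \<in> P \<Longrightarrow> x \<subseteq> E" and route_nonempty: "x \<in> P \<Longrightarrow> x \<noteq> {}"
    and routes_disjoint: "pairwise disjnt P"
    and agents: "n > 0" and interceptors: "k > 0"
    and spread: "x \<in> P \<Longrightarrow> y \<in> P \<Longrightarrow> real (card y) \<le> real (card x) + real k * \<alpha>"
begin

definition profile :: "(nat \<Rightarrow> 'e set pmf) \<Rightarrow> bool" where
  "profile \<sigma> \<longleftrightarrow> (\<forall>i\<in>{1..n}. set_pmf (\<sigma> i) \<subseteq> P)"

definition expected_cost :: "(nat \<Rightarrow> 'e set pmf) \<Rightarrow> (nat \<Rightarrow> 'e) \<Rightarrow> real" where
  "expected_cost \<sigma> d = measure_pmf.expectation (Pi_pmf {1..n} {} \<sigma>) (\<lambda>a. max_cost n k a d \<alpha>)"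

definition worst_cost :: "(nat \<Rightarrow> 'e set pmf) \<Rightarrow> real" where
  "worst_cost \<sigma> = Max (expected_cost \<sigma> ` ({1..k} \<rightarrow>\<^sub>E E))"

lemma finite_interceptions: "finite ({1..k} \<rightarrow>\<^sub>E E)"
  using finite_arcs by (intro finite_PiE) auto

lemma in_route_iff:
  assumes "x \<in> P" "e \<in> x" "z \<in> P"
  shows "e \<in> z \<longleftrightarrow> z = x"
  using assms routes_disjoint by (auto simp: pairwise_def disjnt_def)

lemma support_finite:
  assumes "profile \<sigma>"
  shows "finite (set_pmf (Pi_pmf {1..n} {} \<sigma>))"
  using assms by (intro finite_set_Pi_pmf finite_subset[OF _ finite_routes]) (auto simp: profile_def)

lemma support_routes:
  assumes "profile \<sigma>" "a \<in> set_pmf (Pi_pmf {1..n} {} \<sigma>)" "i \<in> {1..n}"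
  shows "a i \<in> P"
  using assms by (fastforce simp: profile_def set_Pi_pmf PiE_dflt_def)

lemma max_cost_cong:
  "(\<And>j. j \<in> {1..k} \<Longrightarrow> d j = d' j) \<Longrightarrow> max_cost n k a d \<alpha> = max_cost n k a d' \<alpha>"
  by (simp add: max_cost_def cong: sum.cong_simp)

lemma cost_le_max_cost:
  "i \<in> {1..n} \<Longrightarrow> real (card (a i)) + \<alpha> * (\<Sum>j\<in>{1..k}. of_bool (d j \<in> a i)) \<le> max_cost n k a d \<alpha>"
  unfolding max_cost_def by (rule Max_ge) auto

lemma max_cost_le:
  assumes "\<And>i. i \<in> {1..n} \<Longrightarrow> real (card (a i)) + \<alpha> * (\<Sum>j\<in>{1..k}. of_bool (d j \<in> a i)) \<le> b"
  shows "max_cost n k a d \<alpha> \<le> b"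
  unfolding max_cost_def using assms agents by (subst Max_le_iff) auto

lemma expected_cost_le_worst_cost:
  assumes "\<And>j. j \<in> {1..k} \<Longrightarrow> d j \<in> E"
  shows "expected_cost \<sigma> d \<le> worst_cost \<sigma>"
proof -
  \<comment> \<open>The maximum ranges over extensional functions only; restricting first lets
    constant interceptions be used directly.\<close>
  have "expected_cost \<sigma> d = expected_cost \<sigma> (restrict d {1..k})"
    unfolding expected_cost_def
    by (intro arg_cong[where f = "measure_pmf.expectation _"] ext max_cost_cong) simp
  also have "\<dots> \<le> worst_cost \<sigma>"
    unfolding worst_cost_def using finite_interceptions assms by (intro Max_ge) auto
  finally show ?thesis .
qed

text \<open>Convexity of the cost in the interception: concentrating all interceptors on one arc is extremal.\<close>

lemma expected_cost_le_average:
  assumes "profile \<sigma>"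
  shows "expected_cost \<sigma> d \<le> (\<Sum>j\<in>{1..k}. expected_cost \<sigma> (\<lambda>_. d j)) / real k"
proof -
  have "max_cost n k a d \<alpha> \<le> (\<Sum>j\<in>{1..k}. max_cost n k a (\<lambda>_. d j) \<alpha>) / real k" for a
  proof (rule max_cost_le)
    fix i assume i: "i \<in> {1..n}"
    \<comment> \<open>\<open>k\<close> times the cost of one agent is the sum over \<open>j\<close>
      of its costs when all interceptors sit on \<open>d j\<close>.\<close>
    have "real k * (real (card (a i)) + \<alpha> * (\<Sum>j\<in>{1..k}. of_bool (d j \<in> a i)))
        = (\<Sum>j\<in>{1..k}. real (card (a i)) + \<alpha> * (\<Sum>j'\<in>{1..k}. of_bool (d j \<in> a i)))"
      by (simp add: sum.distrib sum_distrib_left[symmetric] distrib_left mult.left_commute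
          del: sum_of_bool_eq)
    also have "\<dots> \<le> (\<Sum>j\<in>{1..k}. max_cost n k a (\<lambda>_. d j) \<alpha>)"
      using i by (intro sum_mono cost_le_max_cost)
    finally show "real (card (a i)) + \<alpha> * (\<Sum>j\<in>{1..k}. of_bool (d j \<in> a i))
        \<le> (\<Sum>j\<in>{1..k}. max_cost n k a (\<lambda>_. d j) \<alpha>) / real k"
      using interceptors by (simp add: field_simps)
  qed
  then have "expected_cost \<sigma> d \<le> measure_pmf.expectation (Pi_pmf {1..n} {} \<sigma>)
      (\<lambda>a. (\<Sum>j\<in>{1..k}. max_cost n k a (\<lambda>_. d j) \<alpha>) / real k)"
    unfolding expected_cost_def by (intro expectation_mono_on_support support_finite assms)
  also have "\<dots> = (\<Sum>j\<in>{1..k}. expected_cost \<sigma> (\<lambda>_. d j)) / real k"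
    unfolding expected_cost_def
    by (subst integral_divide_zero, subst Bochner_Integration.integral_sum)
      (auto intro!: integrable_measure_pmf_finite support_finite assms simp del: One_nat_def)
  finally show ?thesis .
qed

text \<open>By disjointness \<open>e\<close> lies on no other route, and by \<open>spread\<close>
  the route \<open>x\<close>, once used, attains the maximum; otherwise only lengths count.\<close>

lemma max_cost_concentrated:
  assumes x: "x \<in> P" "e \<in> x" and a: "\<And>i. i \<in> {1..n} \<Longrightarrow> a i \<in> P"
  shows "max_cost n k a (\<lambda>_. e) \<alpha> =
    (if x \<in> a ` {1..n} then real (card x) + real k * \<alpha> else Max ((\<lambda>z. real (card z)) ` a ` {1..n}))"
proof -
  have *: "max_cost n k a (\<lambda>_. e) \<alpha>
      = Max ((\<lambda>z. real (card z) + real k * \<alpha> * of_bool (z = x)) ` a ` {1..n})"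
    unfolding max_cost_def image_image using a x
    by (intro arg_cong[where f = Max] image_cong) (auto simp: in_route_iff[OF x])
  show ?thesis
  proof (cases "x \<in> a ` {1..n}")
    case True
    have "Max ((\<lambda>z. real (card z) + real k * \<alpha> * of_bool (z = x)) ` a ` {1..n}) = real (card x) + real k * \<alpha>"
      using True a x spread by (intro Max_eqI) force+
    then show ?thesis using True * by simp
  next
    case False
    then show ?thesis unfolding * by (auto intro!: arg_cong[where f = Max] image_cong)
  qed
qed

section \<open>Perturbing the strategy of one agent\<close>

text \<open>Let agent 1 play \<open>x\<close> with extra probability \<epsilon>. Every expected cost
  is affine in \<epsilon>: interceptions with slack at \<epsilon> = 0 keep it by continuity, the
  others start at or below the worst cost with negative slope. There are finitely many
  interceptions, so one \<epsilon> serves all.\<close>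

lemma improvement:
  assumes \<sigma>: "profile \<sigma>" and x: "x \<in> P"
    and better: "\<And>d. d \<in> {1..k} \<rightarrow>\<^sub>E E \<Longrightarrow> expected_cost \<sigma> d < worst_cost \<sigma>
                    \<or> expected_cost (\<sigma>(1 := return_pmf x)) d < expected_cost \<sigma> d"
  obtains \<mu> where "set_pmf \<mu> \<subseteq> P" "worst_cost (\<sigma>(1 := \<mu>)) < worst_cost \<sigma>"
proof -
  let ?c = "\<lambda>\<epsilon> d. (1 - \<epsilon>) * expected_cost \<sigma> d + \<epsilon> * expected_cost (\<sigma>(1 := return_pmf x)) d"
  have "\<forall>\<^sub>F \<epsilon> in at_right 0. ?c \<epsilon> d < worst_cost \<sigma>" if d: "d \<in> {1..k} \<rightarrow>\<^sub>E E" for d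
    using better[OF d]
  proof
    assume "expected_cost \<sigma> d < worst_cost \<sigma>"
    moreover have "((\<lambda>\<epsilon>. ?c \<epsilon> d) \<longlongrightarrow> ?c 0 d) (at_right 0)" by (intro tendsto_intros)
    ultimately show ?thesis by (intro order_tendstoD) auto
  next
    assume less: "expected_cost (\<sigma>(1 := return_pmf x)) d < expected_cost \<sigma> d"
    have le: "expected_cost \<sigma> d \<le> worst_cost \<sigma>" using d by (intro expected_cost_le_worst_cost) auto
    have "?c \<epsilon> d < worst_cost \<sigma>" if "0 < \<epsilon>" for \<epsilon>
      using mult_strict_left_mono[OF less that] le by (simp add: algebra_simps)
    then show ?thesis by (intro eventually_at_right_less[THEN eventually_mono]) auto
  qed
  then have "\<forall>\<^sub>F \<epsilon> in at_right 0. \<forall>d\<in>{1..k} \<rightarrow>\<^sub>E E. ?c \<epsilon> d < worst_cost \<sigma>"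
    using finite_interceptions by (intro eventually_ball_finite) auto
  moreover have "\<forall>\<^sub>F \<epsilon> in at_right 0. (0::real) < \<epsilon> \<and> \<epsilon> < 1"
    by (intro eventually_conj eventually_at_right_less order_tendstoD[OF tendsto_ident_at]) auto
  ultimately have "\<forall>\<^sub>F \<epsilon> in at_right 0. (0 < \<epsilon> \<and> \<epsilon> < 1) \<and> (\<forall>d\<in>{1..k} \<rightarrow>\<^sub>E E. ?c \<epsilon> d < worst_cost \<sigma>)"
    by (rule eventually_conj[rotated])
  then obtain \<epsilon> where \<epsilon>: "0 < \<epsilon>" "\<epsilon> < 1" "\<And>d. d \<in> {1..k} \<rightarrow>\<^sub>E E \<Longrightarrow> ?c \<epsilon> d < worst_cost \<sigma>"
    using eventually_happens'[OF trivial_limit_at_right_real] by blast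
  define \<mu> where "\<mu> = bind_pmf (bernoulli_pmf \<epsilon>) (\<lambda>b. if b then return_pmf x else \<sigma> 1)"
  have "expected_cost (\<sigma>(1 := \<mu>)) d = ?c \<epsilon> d" for d
    unfolding expected_cost_def \<mu>_def
    using \<sigma> x \<epsilon> finite_routes agents
    by (intro expectation_Pi_pmf_mixture[where S = P]) (auto simp: profile_def)
  moreover have "{1..k} \<rightarrow>\<^sub>E E \<noteq> {}"
    using route_arcs[OF x] route_nonempty[OF x] by (auto simp: PiE_eq_empty_iff)
  ultimately have "worst_cost (\<sigma>(1 := \<mu>)) < worst_cost \<sigma>"
    unfolding worst_cost_def[of "\<sigma>(1 := \<mu>)"] using finite_interceptions \<epsilon>(3)
    by (subst Max_less_iff) auto
  moreover have "set_pmf \<mu> \<subseteq> P"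
  proof -
    have "set_pmf (\<sigma> 1) \<subseteq> P" using \<sigma> agents by (simp add: profile_def)
    then show ?thesis using x by (auto simp: \<mu>_def subset_iff split: if_splits)
  qed
  ultimately show thesis by (rule that[rotated])
qed

text \<open>A route free of interceptors costs just its length, so moving agent 1 to a shortest such
  route never raises the maximum. For strictness, one outcome in the support where it drops is
  enough.\<close>

lemma expected_cost_redirect_less:
  assumes \<sigma>: "profile \<sigma>" and x: "x \<in> P" and y: "y \<in> set_pmf (\<sigma> 1)" "card x < card y"
    and x_supp: "\<And>i. i \<in> {1..n} \<Longrightarrow> x \<in> set_pmf (\<sigma> i)"
    and shortest: "\<And>z. z \<in> P \<Longrightarrow> card x \<le> card z"
    and \<alpha>: "\<alpha> \<ge> 0" and d: "\<And>j. j \<in> {1..k} \<Longrightarrow> d j \<notin> x"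
  shows "expected_cost (\<sigma>(1 := return_pmf x)) d < expected_cost \<sigma> d"
proof -
  have load_x: "(\<Sum>j\<in>{1..k}. of_bool (d j \<in> x)) = (0::real)" using d by (intro sum.neutral) auto
  have load_ge: "real (card z) \<le> real (card z) + \<alpha> * (\<Sum>j\<in>{1..k}. of_bool (d j \<in> z))" for z
    using \<alpha> by (simp add: sum_nonneg)
  have one: "1 \<in> {1..n}" using agents by auto
  \<comment> \<open>Agent 1 on \<open>y\<close>, all others on \<open>x\<close>: redirecting agent 1
    leaves everyone on \<open>x\<close>. The value \<open>{}\<close> outside \<open>{1..n}\<close>
    is the default of the product, as membership in its support requires.\<close>
  let ?b = "(\<lambda>i. if i \<in> {1..n} then x else {})(1 := y)"
  have "measure_pmf.expectation (Pi_pmf {1..n} {} \<sigma>) (\<lambda>a. max_cost n k (a(1 := x)) d \<alpha>)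
      < expected_cost \<sigma> d"
    unfolding expected_cost_def
  proof (rule expectation_strict_mono_on_support)
    show "finite (set_pmf (Pi_pmf {1..n} {} \<sigma>))" by (rule support_finite[OF \<sigma>])
    fix a assume a: "a \<in> set_pmf (Pi_pmf {1..n} {} \<sigma>)"
    have "real (card x) \<le> max_cost n k a d \<alpha>"
      using shortest[OF support_routes[OF \<sigma> a one]] load_ge[of "a 1"] cost_le_max_cost[OF one, of a d]
      by linarith
    then show "max_cost n k (a(1 := x)) d \<alpha> \<le> max_cost n k a d \<alpha>"
      using cost_le_max_cost[of _ a d] load_x by (intro max_cost_le) auto
  next
    show "?b \<in> set_pmf (Pi_pmf {1..n} {} \<sigma>)"
      using y x_supp one by (auto simp: set_Pi_pmf PiE_dflt_def)
    have "max_cost n k (?b(1 := x)) d \<alpha> \<le> real (card x)"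
      using load_x by (intro max_cost_le) auto
    also have "\<dots> < real (card y)" using y by simp
    also have "\<dots> \<le> max_cost n k ?b d \<alpha>"
      using load_ge[of y] cost_le_max_cost[OF one, of ?b d] by simp
    finally show "max_cost n k (?b(1 := x)) d \<alpha> < max_cost n k ?b d \<alpha>" .
  qed
  then show ?thesis
    unfolding expected_cost_def using one by (simp add: expectation_Pi_pmf_return_upd)
qed

text \<open>
  Exchanging \<open>x\<close> and \<open>y\<close> preserves the uniform profile. Summed over an exchange orbit, the cost
  difference is nonnegative, and it is positive once both routes are in use, which needs two agents.
\<close>

lemma uniform_concentrated_less:
  assumes n: "n > 1" and Q: "Q \<subseteq> P" "x \<in> Q" "y \<in> Q" and shorter: "card x < card y"
    and e: "e \<in> x" and f: "f \<in> y"
  shows "expected_cost (\<lambda>_. pmf_of_set Q) (\<lambda>_. e) < expected_cost (\<lambda>_. pmf_of_set Q) (\<lambda>_. f)"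
proof -
  have finQ: "finite Q" "Q \<noteq> {}" using Q finite_routes finite_subset by auto
  have prof: "profile (\<lambda>_. pmf_of_set Q)" using finQ Q by (auto simp: profile_def)
  let ?\<tau> = "Transposition.transpose x y" and ?M = "Pi_pmf {1..n} {} (\<lambda>_. pmf_of_set Q)"
  let ?C = "\<lambda>g a. max_cost n k a (\<lambda>_. g) \<alpha>"
  let ?L = "\<lambda>a. Max ((\<lambda>z. real (card z)) ` a ` {1..n})"
  \<comment> \<open>The interceptors' gain from aiming at the longer route instead of the shorter
    one.\<close>
  define h where "h a = ?C f a - ?C e a" for a
  have xyP: "x \<in> P" "y \<in> P" using Q by auto
  have "map_pmf ?\<tau> (pmf_of_set Q) = pmf_of_set Q"
    using Q finQ by (intro map_pmf_of_set_bij_betw) (auto simp: bij_betw_transpose_iff)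
  \<comment> \<open>Mapping a product distribution coordinatewise must also fix the default
    \<open>{}\<close>; it does because routes are nonempty.\<close>
  moreover have "?\<tau> {} = {}" using xyP route_nonempty by (auto simp: Transposition.transpose_def)
  ultimately have inv: "map_pmf (\<lambda>a. ?\<tau> \<circ> a) ?M = ?M"
    using Pi_pmf_map[of "{1..n}" ?\<tau> "{}" "{}" "\<lambda>_. pmf_of_set Q"] by simp
  have range: "a i \<in> P" "(?\<tau> \<circ> a) i \<in> P" if "a \<in> set_pmf ?M" "i \<in> {1..n}" for a i
    using support_routes[OF prof that] xyP by (auto simp: Transposition.transpose_def)
  have C: "?C e a = (if x \<in> a ` {1..n} then real (card x) + real k * \<alpha> else ?L a)"
          "?C f a = (if y \<in> a ` {1..n} then real (card y) + real k * \<alpha> else ?L a)"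
    if "\<And>i. i \<in> {1..n} \<Longrightarrow> a i \<in> P" for a
    using max_cost_concentrated[OF xyP(1) e that] max_cost_concentrated[OF xyP(2) f that] by auto
  have mem: "x \<in> (?\<tau> \<circ> a) ` {1..n} \<longleftrightarrow> y \<in> a ` {1..n}" "y \<in> (?\<tau> \<circ> a) ` {1..n} \<longleftrightarrow> x \<in> a ` {1..n}" for a
  proof -
    have "z = ?\<tau> w \<longleftrightarrow> ?\<tau> z = w" for z w using transpose_involutory[of x y] by metis
    then have "z \<in> (?\<tau> \<circ> a) ` {1..n} \<longleftrightarrow> ?\<tau> z \<in> a ` {1..n}" for z
      by (simp only: image_iff comp_def)
    then show "x \<in> (?\<tau> \<circ> a) ` {1..n} \<longleftrightarrow> y \<in> a ` {1..n}" "y \<in> (?\<tau> \<circ> a) ` {1..n} \<longleftrightarrow> x \<in> a ` {1..n}"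
      by (simp_all only: transpose_apply_first transpose_apply_second)
  qed
  have L: "?L a \<le> ?L (?\<tau> \<circ> a) + (real (card y) - real (card x))" if "x \<notin> a ` {1..n}" for a
  proof -
    have "real (card (a i)) \<le> ?L (?\<tau> \<circ> a) + (real (card y) - real (card x))" if i: "i \<in> {1..n}" for i
    proof -
      have "a i \<noteq> x" using \<open>x \<notin> a ` {1..n}\<close> i by blast
      then have "real (card (a i)) \<le> real (card ((?\<tau> \<circ> a) i)) + (real (card y) - real (card x))"
        using shorter by (auto simp: Transposition.transpose_def)
      also have "real (card ((?\<tau> \<circ> a) i)) \<le> ?L (?\<tau> \<circ> a)" using i by (intro Max_ge) auto
      finally show ?thesis by simp
    qed
    then show ?thesis using agents by (subst Max_le_iff) auto
  qed
  have h: "h a = (if y \<in> a ` {1..n} then real (card y) + real k * \<alpha> else ?L a)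
        - (if x \<in> a ` {1..n} then real (card x) + real k * \<alpha> else ?L a)"
      "h (?\<tau> \<circ> a) = (if x \<in> a ` {1..n} then real (card y) + real k * \<alpha> else ?L (?\<tau> \<circ> a))
        - (if y \<in> a ` {1..n} then real (card x) + real k * \<alpha> else ?L (?\<tau> \<circ> a))"
    if a: "a \<in> set_pmf ?M" for a
  proof -
    have "\<And>i. i \<in> {1..n} \<Longrightarrow> a i \<in> P" using range(1)[OF a] .
    then show "h a = (if y \<in> a ` {1..n} then real (card y) + real k * \<alpha> else ?L a)
        - (if x \<in> a ` {1..n} then real (card x) + real k * \<alpha> else ?L a)"
      by (simp only: h_def C)
    have "\<And>i. i \<in> {1..n} \<Longrightarrow> (?\<tau> \<circ> a) i \<in> P" using range(2)[OF a] .
    then show "h (?\<tau> \<circ> a) = (if x \<in> a ` {1..n} then real (card y) + real k * \<alpha> else ?L (?\<tau> \<circ> a))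
        - (if y \<in> a ` {1..n} then real (card x) + real k * \<alpha> else ?L (?\<tau> \<circ> a))"
      by (simp only: h_def C mem)
  qed
  \<comment> \<open>If both routes are used the sum is twice the length difference, if neither is it
    is 0. If exactly one is, the terms in \<alpha> cancel, and \<open>L\<close> bounds the remaining
    difference of greatest lengths.\<close>
  have orbit: "0 \<le> h a + h (?\<tau> \<circ> a)" if "a \<in> set_pmf ?M" for a
  proof -
    have "?\<tau> \<circ> (?\<tau> \<circ> a) = a" by (simp add: fun_eq_iff)
    then have "x \<in> a ` {1..n} \<or> ?L a \<le> ?L (?\<tau> \<circ> a) + (real (card y) - real (card x))"
      "y \<in> a ` {1..n} \<or> ?L (?\<tau> \<circ> a) \<le> ?L a + (real (card y) - real (card x))"
      using L[of a] L[of "?\<tau> \<circ> a"] by (metis, metis mem(1))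
    then show ?thesis using shorter unfolding h[OF that] by (elim disjE) simp_all
  qed
  \<comment> \<open>An outcome using both routes: agent 1 takes \<open>y\<close> and agent 2,
    present since \<open>n > 1\<close>, takes \<open>x\<close>.\<close>
  let ?b = "(\<lambda>i. if i \<in> {1..n} then x else {})(1 := y)"
  have b: "?b \<in> set_pmf ?M"
    using Q finQ n by (auto simp: set_Pi_pmf PiE_dflt_def)
  have xy_b: "x \<in> ?b ` {1..n}" "y \<in> ?b ` {1..n}"
    by (rule image_eqI[of _ _ 2]; use n in simp) (rule image_eqI[of _ _ 1]; use n in simp)
  have int: "integrable (measure_pmf ?M) g" for g :: "(nat \<Rightarrow> 'e set) \<Rightarrow> real"
    by (intro integrable_measure_pmf_finite support_finite prof)
  have "0 < measure_pmf.expectation ?M (\<lambda>a. h a + h (?\<tau> \<circ> a))"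
  proof -
    have "measure_pmf.expectation ?M (\<lambda>_. 0) < measure_pmf.expectation ?M (\<lambda>a. h a + h (?\<tau> \<circ> a))"
    proof (rule expectation_strict_mono_on_support[OF support_finite[OF prof] orbit b])
      show "0 < h ?b + h (?\<tau> \<circ> ?b)"
        using xy_b shorter unfolding h[OF b] by simp
    qed
    then show ?thesis by simp
  qed
  \<comment> \<open>By invariance under the exchange both summands have the same mean, so a positive
    orbit sum gives a positive mean gain.\<close>
  also have "\<dots> = measure_pmf.expectation ?M h + measure_pmf.expectation (map_pmf (\<lambda>a. ?\<tau> \<circ> a) ?M) h"
    by (simp add: int del: One_nat_def)
  also have "\<dots> = 2 * (measure_pmf.expectation ?M (?C f) - measure_pmf.expectation ?M (?C e))"
    unfolding inv by (simp add: h_def[abs_def] int del: One_nat_def)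
  finally show ?thesis by (simp add: expected_cost_def)
qed

lemma uniform_improvable:
  assumes n: "n > 1" and \<alpha>: "\<alpha> \<ge> 0" and Q: "Q \<subseteq> P" "x \<in> Q" "y \<in> Q"
    and shorter: "card x < card y" and shortest: "\<And>z. z \<in> P \<Longrightarrow> card x \<le> card z"
  obtains \<mu> where "set_pmf \<mu> \<subseteq> P"
    "worst_cost ((\<lambda>_. pmf_of_set Q)(1 := \<mu>)) < worst_cost (\<lambda>_. pmf_of_set Q)"
proof -
  have finQ: "finite Q" "Q \<noteq> {}" using Q finite_routes finite_subset by auto
  let ?U = "\<lambda>_ :: nat. pmf_of_set Q"
  have prof: "profile ?U" using finQ Q by (auto simp: profile_def)
  obtain f where f: "f \<in> y" using route_nonempty Q by blast
  show thesis
  proof (rule improvement[OF prof, of x])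
    fix d assume d: "d \<in> {1..k} \<rightarrow>\<^sub>E E"
    show "expected_cost ?U d < worst_cost ?U
        \<or> expected_cost (?U(1 := return_pmf x)) d < expected_cost ?U d"
    proof (cases "\<exists>r\<in>{1..k}. d r \<in> x")
      case True
      then obtain r where r: "r \<in> {1..k}" "d r \<in> x" by auto
      have "expected_cost ?U (\<lambda>_. d r) < expected_cost ?U (\<lambda>_. f)"
        using n Q shorter r(2) f by (rule uniform_concentrated_less)
      also have "\<dots> \<le> worst_cost ?U"
        using f route_arcs Q by (intro expected_cost_le_worst_cost) auto
      finally have "expected_cost ?U (\<lambda>_. d r) < worst_cost ?U" .
      \<comment> \<open>One of the concentrated costs lies strictly below the worst cost and none
        exceeds it, so their average, which bounds the cost of \<open>d\<close>, is strictly below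
        too.\<close>
      then have "(\<Sum>j\<in>{1..k}. expected_cost ?U (\<lambda>_. d j)) < (\<Sum>j\<in>{1..k}. worst_cost ?U)"
        using r(1) d
        by (intro sum_strict_mono_ex1) (auto intro!: expected_cost_le_worst_cost bexI[of _ r])
      then have "(\<Sum>j\<in>{1..k}. expected_cost ?U (\<lambda>_. d j)) / real k < worst_cost ?U"
        using interceptors by (simp add: field_simps)
      then show ?thesis using expected_cost_le_average[OF prof, of d] by simp
    next
      case False
      then show ?thesis
        using expected_cost_redirect_less[OF prof, of x y d] Q finQ shorter shortest \<alpha> by auto
    qed
  qed (use Q that in auto)
qed

section \<open>Lower bound on the cost of uniform profiles\<close>

text \<open>Put all interceptors on one arc of a shortest route \<open>x\<close>. The cost is at
  least the length of \<open>x\<close>, plus \<open>k * \<alpha>\<close> whenever some agent uses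
  \<open>x\<close>; all \<open>n\<close> independent agents miss it with probability
  \<open>(1 - 1 / card Q) ^ n\<close>.\<close>

lemma uniform_worst_cost_ge:
  assumes \<alpha>: "\<alpha> \<ge> 0" and Q: "Q \<subseteq> P" "x \<in> Q" and shortest: "\<And>z. z \<in> P \<Longrightarrow> card x \<le> card z"
  shows "real (card x) + (1 - (1 - 1 / real (card Q)) ^ n) * real k * \<alpha>
           \<le> worst_cost (\<lambda>_. pmf_of_set Q)"
proof -
  have finQ: "finite Q" "Q \<noteq> {}" using Q finite_routes finite_subset by auto
  let ?U = "\<lambda>_ :: nat. pmf_of_set Q"
  let ?M = "Pi_pmf {1..n} {} ?U" and ?B = "PiE_dflt {1..n} {} (\<lambda>_. - {x})"
  have prof: "profile ?U" using finQ Q by (auto simp: profile_def)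
  obtain e where e: "e \<in> x" using route_nonempty Q by blast
  have xP: "x \<in> P" using Q by auto
  have int: "integrable (measure_pmf ?M) g" for g :: "(nat \<Rightarrow> 'e set) \<Rightarrow> real"
    by (intro integrable_measure_pmf_finite support_finite prof)
  have "measure_pmf.prob (pmf_of_set Q) (- {x}) = 1 - 1 / real (card Q)"
    using Q finQ measure_pmf.prob_compl[of "{x}" "pmf_of_set Q"]
    by (simp add: Compl_eq_Diff_UNIV measure_pmf_single)
  then have prob: "measure_pmf.prob ?M ?B = (1 - 1 / real (card Q)) ^ n"
    by (simp add: measure_Pi_pmf_PiE_dflt)
  have "real (card x) + (1 - (1 - 1 / real (card Q)) ^ n) * real k * \<alpha>
      = measure_pmf.expectation ?M (\<lambda>a. real (card x) + real k * \<alpha> * (1 - indicator ?B a))"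
    by (subst Bochner_Integration.integral_add[OF int int], subst integral_mult_right_zero,
        subst Bochner_Integration.integral_diff[OF int int])
      (simp add: prob[simplified] mult_ac)
  also have "\<dots> \<le> expected_cost ?U (\<lambda>_. e)"
    unfolding expected_cost_def
  proof (rule expectation_mono_on_support[OF support_finite[OF prof]])
    fix a assume a: "a \<in> set_pmf ?M"
    have aP: "a i \<in> P" if "i \<in> {1..n}" for i using support_routes[OF prof a that] .
    have "a \<in> ?B \<longleftrightarrow> x \<notin> a ` {1..n}" using a by (auto simp: PiE_dflt_def set_Pi_pmf)
    moreover have "real (card x) \<le> Max ((\<lambda>z. real (card z)) ` a ` {1..n})"
      using shortest[OF aP[of 1]] agents by (subst Max_ge_iff) (auto intro!: bexI[of _ 1])
    moreover have "max_cost n k a (\<lambda>_. e) \<alpha> = (if x \<in> a ` {1..n} then real (card x) + real k * \<alpha>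
        else Max ((\<lambda>z. real (card z)) ` a ` {1..n}))"
      using max_cost_concentrated[OF xP e] aP .
    ultimately show "real (card x) + real k * \<alpha> * (1 - indicator ?B a) \<le> max_cost n k a (\<lambda>_. e) \<alpha>"
      by (simp add: indicator_def)
  qed
  also have "\<dots> \<le> worst_cost ?U" using e route_arcs xP by (intro expected_cost_le_worst_cost) auto
  finally show ?thesis .
qed

section \<open>Attainment of the optimal cost\<close>

lemma expected_cost_cong:
  "(\<And>i. i \<in> {1..n} \<Longrightarrow> \<sigma> i = \<tau> i) \<Longrightarrow> expected_cost \<sigma> d = expected_cost \<tau> d"
  unfolding expected_cost_def by (simp only: Pi_pmf_cong[of "{1..n}" "{1..n}" "{}" "{}" \<sigma> \<tau>])

lemma worst_cost_cong:
  "(\<And>i. i \<in> {1..n} \<Longrightarrow> \<sigma> i = \<tau> i) \<Longrightarrow> worst_cost \<sigma> = worst_cost \<tau>"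
  unfolding worst_cost_def by (intro arg_cong[where f = Max] image_cong refl expected_cost_cong)

lemma worst_cost_attains_min:
  assumes "P \<noteq> {}"
  obtains \<sigma> where "profile \<sigma>" "\<And>\<tau>. profile \<tau> \<Longrightarrow> worst_cost \<sigma> \<le> worst_cost \<tau>"
proof -
  \<comment> \<open>The worst cost as a maximum of finitely many polynomials, defined for arbitrary
    real tables so that continuity is immediate.\<close>
  define \<Phi> where "\<Phi> q = Max ((\<lambda>d. \<Sum>a\<in>PiE_dflt {1..n} {} (\<lambda>_. P).
      (\<Prod>i\<in>{1..n}. q (i, a i)) * max_cost n k a d \<alpha>) ` ({1..k} \<rightarrow>\<^sub>E E))"
    for q :: "nat \<times> 'e set \<Rightarrow> real"
  have "E \<noteq> {}" using assms route_arcs route_nonempty by blast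
  then have "{1..k} \<rightarrow>\<^sub>E E \<noteq> {}" by (simp add: PiE_eq_empty_iff)
  then have cont: "continuous_on UNIV \<Phi>"
    unfolding \<Phi>_def using finite_interceptions
    by (intro continuous_on_Max_image continuous_on_sum continuous_on_mult continuous_on_prod
        continuous_on_const continuous_on_product_coordinates)
  have \<Phi>: "\<Phi> (\<lambda>(i, x). pmf (\<tau> i) x) = worst_cost \<tau>" if "profile \<tau>" for \<tau>
    using that finite_routes unfolding \<Phi>_def worst_cost_def expected_cost_def profile_def
    by (intro arg_cong[where f = Max] image_cong refl) (subst expectation_Pi_pmf_eq_sum[where S = P]; auto)
  obtain \<sigma> where \<sigma>: "\<And>i. set_pmf (\<sigma> i) \<subseteq> P"
    "\<And>\<tau>. (\<And>i. set_pmf (\<tau> i) \<subseteq> P) \<Longrightarrow> \<Phi> (\<lambda>(i, x). pmf (\<sigma> i) x) \<le> \<Phi> (\<lambda>(i, x). pmf (\<tau> i) x)"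
    using pmf_profiles_attain_min[OF finite_routes assms cont] by blast
  have prof: "profile \<sigma>" using \<sigma>(1) by (simp add: profile_def)
  have "worst_cost \<sigma> \<le> worst_cost \<tau>" if \<tau>: "profile \<tau>" for \<tau>
  proof -
    \<comment> \<open>The compactness argument compares tables supported on \<open>P\<close> at
      every index, so \<open>\<tau>\<close> is patched with \<open>\<sigma>\<close> outside
      \<open>{1..n}\<close>.\<close>
    let ?\<tau> = "\<lambda>i. if i \<in> {1..n} then \<tau> i else \<sigma> i"
    have "profile ?\<tau>" "\<And>i. set_pmf (?\<tau> i) \<subseteq> P" using \<tau> \<sigma>(1) by (auto simp: profile_def)
    then have "worst_cost \<sigma> \<le> worst_cost ?\<tau>" using \<sigma>(2)[of ?\<tau>] \<Phi> prof by metis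
    also have "\<dots> = worst_cost \<tau>" by (rule worst_cost_cong) simp
    finally show ?thesis .
  qed
  then show thesis using prof that by blast
qed

end

section \<open>Application to the graph and comparison with uniform profiles\<close>

theorem theorem12:
  fixes G :: "('v, 'e) pre_digraph" and s t :: 'v
    and p :: "nat \<Rightarrow> 'e set" and m m1 n k :: nat and \<alpha> :: real
  assumes graph: "st_graph G s t"
    and paths: "bij_betw p {1..m} (st_paths G s t)"
    and m: "m > 1"
    and disjoint: "pairwise disjnt (st_paths G s t)"
    and sorted: "\<And>i j. 1 \<le> i \<Longrightarrow> i \<le> j \<Longrightarrow> j \<le> m \<Longrightarrow> card (p i) \<le> card (p j)"
    and shorter: "card (p 1) < card (p m)"
    and m1: "m1 = Max {l \<in> {1..m}. \<forall>i\<in>{1..l}. card (p i) = card (p 1)}"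
    and n: "n > 1" and k: "k > 1"
    and \<alpha>: "\<alpha> > (real (card (p m)) - real (card (p 1))) / real k"
    and below: "minimum (\<lambda>\<sigma>. F_max G n k \<sigma> \<alpha>) (path_profiles G s t n)
                  < real (card (p 1)) + \<E> m1 n / real m1 * real k * \<alpha>"
  shows "minimum (\<lambda>\<sigma>. F_max G n k \<sigma> \<alpha>) (path_profiles G s t n)
           < minimum (\<lambda>\<sigma>. F_max G n k \<sigma> \<alpha>) (uniform_profiles p m n)"
proof -
  let ?P = "st_paths G s t"
  interpret st_graph G s t by fact
  have P_eq: "?P = p ` {1..m}" using paths by (simp add: bij_betw_def)
  have inj: "inj_on p {1..m}" using paths by (simp add: bij_betw_def)
  have \<alpha>0: "\<alpha> > 0"
    using \<alpha> shorter by (smt (verit) divide_nonneg_nonneg of_nat_0_le_iff of_nat_less_iff)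
  have spread: "real (card (p m)) < real (card (p 1)) + real k * \<alpha>"
    using \<alpha> k by (simp add: field_simps)
  have p1_le: "card (p 1) \<le> card z" and le_pm: "card z \<le> card (p m)" if "z \<in> ?P" for z
    using that sorted m by (auto simp: P_eq)
  interpret R: disjoint_routes "arcs G" ?P n k \<alpha>
  proof
    show "finite (arcs G)" by (rule finite_arcs)
    show "finite ?P" by (simp add: P_eq)
    show "x \<subseteq> arcs G" if "x \<in> ?P" for x
      using that by (auto simp: st_paths_def apath_def awalk_def)
    \<comment> \<open>An empty walk would force \<open>s = t\<close>.\<close>
    show "x \<noteq> {}" if "x \<in> ?P" for x
      using that source_neq_sink by (auto simp: st_paths_def apath_def awalk_def)
    show "real (card y) \<le> real (card x) + real k * \<alpha>" if "x \<in> ?P" "y \<in> ?P" for x y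
      using p1_le[OF that(1)] le_pm[OF that(2)] spread by linarith
  qed (use disjoint n k in auto)
  have F: "F_max G n k \<sigma> \<alpha> = R.worst_cost \<sigma>" for \<sigma>
    by (simp add: F_max_def R.worst_cost_def R.expected_cost_def[abs_def])
  have prof_iff: "R.profile \<sigma>" if "\<sigma> \<in> path_profiles G s t n" for \<sigma>
    using that by (auto simp: path_profiles_def R.profile_def PiE_def Pi_def)
  \<comment> \<open>Strategy profiles of the graph are extensional, those of the locale are not;
    restriction passes between them without changing the cost.\<close>
  have restrict_in: "restrict \<sigma> {1..n} \<in> path_profiles G s t n" if "R.profile \<sigma>" for \<sigma>
    using that by (auto simp: path_profiles_def R.profile_def)
  have F_restrict: "F_max G n k (restrict \<sigma> {1..n}) \<alpha> = R.worst_cost \<sigma>" for \<sigma>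
    unfolding F by (rule R.worst_cost_cong) simp
  let ?V = "minimum (\<lambda>\<sigma>. F_max G n k \<sigma> \<alpha>) (path_profiles G s t n)"
  have "?P \<noteq> {}" using m by (auto simp: P_eq)
  then obtain \<sigma> where \<sigma>: "R.profile \<sigma>" "\<And>\<tau>. R.profile \<tau> \<Longrightarrow> R.worst_cost \<sigma> \<le> R.worst_cost \<tau>"
    using R.worst_cost_attains_min by blast
  have "?V = F_max G n k (restrict \<sigma> {1..n}) \<alpha>"
    by (intro minimum_eqI restrict_in \<sigma>(1)) (simp only: F_restrict, simp only: F \<sigma>(2) prof_iff)
  then have V: "?V \<le> R.worst_cost \<tau>" if "R.profile \<tau>" for \<tau>
    using \<sigma>(2)[OF that] by (simp only: F_restrict)

  have "m1 \<in> {l \<in> {1..m}. \<forall>i\<in>{1..l}. card (p i) = card (p 1)}"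
    unfolding m1 using m by (intro Max_in) (auto intro!: exI[of _ 1])
  then have m1_range: "1 \<le> m1" "m1 \<le> m" by auto
  have long: "card (p 1) < card (p i)" if i: "m1 < i" "i \<le> m" for i
  proof (rule ccontr)
    assume not_less: "\<not> card (p 1) < card (p i)"
    \<comment> \<open>Otherwise sortedness squeezes all of the first \<open>i\<close> lengths to
      that of \<open>p 1\<close>, and \<open>i\<close> would contradict the maximality of
      \<open>m1\<close>.\<close>
    have "card (p j) = card (p 1)" if "j \<in> {1..i}" for j
    proof -
      have "card (p 1) \<le> card (p j)" "card (p j) \<le> card (p i)"
        using that i by (intro sorted; simp)+
      then show ?thesis using not_less by linarith
    qed
    moreover have "i \<in> {1..m}" using i by auto
    ultimately have mem: "i \<in> {l \<in> {1..m}. \<forall>i\<in>{1..l}. card (p i) = card (p 1)}" by blast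
    have "i \<le> m1" unfolding m1 by (rule Max_ge[OF _ mem]) simp
    then show False using i by simp
  qed

  have uniform: "?V < R.worst_cost (\<lambda>_. pmf_of_set (p ` {1..i}))" if i: "i \<in> {1..m}" for i
  proof (cases "i \<le> m1")
    case True
    have sub: "p ` {1..i} \<subseteq> ?P" "p 1 \<in> p ` {1..i}" using i by (auto simp: P_eq)
    have "card (p ` {1..i}) = i"
      using i by (subst card_image) (auto intro: inj_on_subset[OF inj])
    then have "real (card (p 1)) + (1 - (1 - 1 / real i) ^ n) * real k * \<alpha>
        \<le> R.worst_cost (\<lambda>_. pmf_of_set (p ` {1..i}))"
      using R.uniform_worst_cost_ge[OF _ sub p1_le] \<alpha>0 by simp
    \<comment> \<open>Fewer paths make it likelier that \<open>p 1\<close> is used, so the bound for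
      \<open>i\<close> is at least the one for \<open>m1\<close>.\<close>
    moreover have "(1 - 1 / real i) ^ n \<le> (1 - 1 / real m1) ^ n"
      using True i by (intro power_mono) (auto simp: field_simps)
    then have "(1 - (1 - 1 / real m1) ^ n) * (real k * \<alpha>) \<le> (1 - (1 - 1 / real i) ^ n) * (real k * \<alpha>)"
      using \<alpha>0 by (intro mult_right_mono) auto
    moreover have "\<E> m1 n / real m1 = 1 - (1 - 1 / real m1) ^ n"
      using m1_range by (simp add: \<E>_def)
    ultimately show ?thesis using below by (simp add: mult.assoc)
  next
    case False
    have sub: "p ` {1..i} \<subseteq> ?P" "p 1 \<in> p ` {1..i}" "p i \<in> p ` {1..i}" using i by (auto simp: P_eq)
    obtain \<mu> where \<mu>: "set_pmf \<mu> \<subseteq> ?P"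
      "R.worst_cost ((\<lambda>_. pmf_of_set (p ` {1..i}))(1 := \<mu>)) < R.worst_cost (\<lambda>_. pmf_of_set (p ` {1..i}))"
      using R.uniform_improvable[OF n _ sub long p1_le] False i \<alpha>0 by auto
    have "R.profile ((\<lambda>_. pmf_of_set (p ` {1..i}))(1 := \<mu>))"
      using \<mu>(1) sub(1) i by (auto simp: R.profile_def)
    from V[OF this] \<mu>(2) show ?thesis by simp
  qed

  \<comment> \<open>There are finitely many uniform profiles, so their minimum is the cost of one of
    them, to which \<open>uniform\<close> applies.\<close>
  have "minimum (\<lambda>\<sigma>. F_max G n k \<sigma> \<alpha>) (uniform_profiles p m n)
      \<in> (\<lambda>\<sigma>. F_max G n k \<sigma> \<alpha>) ` uniform_profiles p m n"
  proof -
    have fin: "finite (uniform_profiles p m n)" by (simp add: uniform_profiles_def)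
    have "uniform_profiles p m n \<noteq> {}" using m by (auto simp: uniform_profiles_def)
    from ex_min_if_finite[OF finite_imageI[OF fin, of "\<lambda>\<sigma>. F_max G n k \<sigma> \<alpha>"]] this
    obtain \<tau> where "\<tau> \<in> uniform_profiles p m n"
      "\<And>\<tau>'. \<tau>' \<in> uniform_profiles p m n \<Longrightarrow> F_max G n k \<tau> \<alpha> \<le> F_max G n k \<tau>' \<alpha>"
      by (auto simp: not_less)
    then show ?thesis using minimum_eqI[of \<tau> "uniform_profiles p m n" "\<lambda>\<sigma>. F_max G n k \<sigma> \<alpha>"] by auto
  qed
  then obtain i where i: "i \<in> {1..m}"
    "minimum (\<lambda>\<sigma>. F_max G n k \<sigma> \<alpha>) (uniform_profiles p m n)
       = F_max G n k (\<lambda>_\<in>{1..n}. pmf_of_set (p ` {1..i})) \<alpha>"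
    by (auto simp: uniform_profiles_def)
  then show ?thesis using uniform by (simp only: F_restrict)
qed

end
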